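(* Let $g_n$ be the total number of rows in all truth tables of bracketed implications with $n$ distinct variables, and let $t_n$ and $f_n$ be the numbers of these rows with the value true and false, respectively (so $g_n=t_n+f_n$). Then for every $n\geq 2$, $g_n$ can be partitioned into four cases, $$g_n = t_n^{\#1}+t_n^{\#2}+t_n^{\#3}+f_n,$$ where $$t_n^{\#1}=\sum_{i=1}^{n-1}t_i t_{n-i},\quad t_n^{\#2}=\sum_{i=1}^{n-1}f_i t_{n-i},\quad t_n^{\#3}=\sum_{i=1}^{n-1}f_i f_{n-i},\quad f_n=\sum_{i=1}^{n-1}t_i f_{n-i},$$ with $t_1^{\#1}=t_1^{\#2}=t_1^{\#3}=0$ and $f_1=1$.
   Context: A bracketed implication with $n$ distinct variables is a well-formed formula obtained from $p_1\to p_2\to\cdots\to p_n$ (variables in this fixed order) by fully inserting brackets; for $n=1$ it is the single formula $p_1$. A row is a pair consisting of such a bracketed formula and a valuation assigning a value in $\{0,1\}$ (0 = false, 1 = true) to each of $p_1,\dots,p_n$; its value is the truth value of the formula under the valuation, where $\psi\to\phi$ has value 0 exactly when $\psi$ has value 1 and $\phi$ has value 0. *)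

theory Defs
  imports Main "HOL-Library.FuncSet" "HOL-Library.Disjoint_Sets"
begin

datatype form = Var nat | Imp form form

primrec eval :: "(nat \<Rightarrow> bool) \<Rightarrow> form \<Rightarrow> bool" where
  "eval v (Var i) = v i"
| "eval v (Imp \<psi> \<phi>) = (\<not> (eval v \<psi> \<and> \<not> eval v \<phi>))"

primrec var_list :: "form \<Rightarrow> nat list" where
  "var_list (Var i) = [i]"
| "var_list (Imp \<psi> \<phi>) = var_list \<psi> @ var_list \<phi>"

text \<open>Erasing the brackets of a formula leaves the chain of its variables, read from left to right.
  So the full bracketings of the chain of $p_1, \ldots, p_n$ are the formulas whose variables,
  read from left to right, are exactly $1, \ldots, n$.\<close>

definition bracketed :: "nat \<Rightarrow> form set" where
  "bracketed n = {\<phi>. var_list \<phi> = [1..<Suc n]}"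

text \<open>A valuation assigns truth values to $p_1, \ldots, p_n$ only; outside \<open>{1..n}\<close> it is
  \<open>undefined\<close>, so that there are exactly $2^n$ of them.\<close>

definition valuations :: "nat \<Rightarrow> (nat \<Rightarrow> bool) set" where
  "valuations n = {1..n} \<rightarrow>\<^sub>E (UNIV :: bool set)"

type_synonym row = "form \<times> (nat \<Rightarrow> bool)"

definition row_value :: "row \<Rightarrow> bool" where
  "row_value r = eval (snd r) (fst r)"

definition rows :: "nat \<Rightarrow> row set" where
  "rows n = bracketed n \<times> valuations n"

definition true_rows :: "nat \<Rightarrow> row set" where
  "true_rows n = {r \<in> rows n. row_value r}"

definition false_rows :: "nat \<Rightarrow> row set" where
  "false_rows n = {r \<in> rows n. \<not> row_value r}"

text \<open>The rows whose formula is an implication with antecedent of value \<open>a\<close> and consequent of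
  value \<open>b\<close>. For $n = 1$ there are none, since the only formula is a variable.\<close>

definition case_rows :: "bool \<Rightarrow> bool \<Rightarrow> nat \<Rightarrow> row set" where
  "case_rows a b n =
    {(Imp \<psi> \<phi>, v) | \<psi> \<phi> v. (Imp \<psi> \<phi>, v) \<in> rows n \<and> eval v \<psi> = a \<and> eval v \<phi> = b}"

definition g :: "nat \<Rightarrow> nat" where "g n = card (rows n)"
definition t :: "nat \<Rightarrow> nat" where "t n = card (true_rows n)"
definition f :: "nat \<Rightarrow> nat" where "f n = card (false_rows n)"

text \<open>The three cases in which an implication is true.\<close>

definition t1 :: "nat \<Rightarrow> nat" where "t1 n = card (case_rows True True n)"
definition t2 :: "nat \<Rightarrow> nat" where "t2 n = card (case_rows False True n)"
definition t3 :: "nat \<Rightarrow> nat" where "t3 n = card (case_rows False False n)"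

end

theory Submission
  imports Defs
begin

text \<open>A row of \<open>n\<close> variables whose formula is \<open>Imp \<psi> \<phi>\<close>, with \<open>i\<close> variables in \<open>\<psi>\<close>, splits uniquely into
  a row of \<open>i\<close> variables for \<open>\<psi>\<close> and, after lowering the indices in \<open>\<phi>\<close> by \<open>i\<close>, a row of \<open>n - i\<close>
  variables for \<open>\<phi>\<close>. The values of the two parts decide the case, so every recurrence is this
  bijection with the two values prescribed.\<close>

section \<open>Index shifts, evaluation, finiteness\<close>

primrec shift :: "nat \<Rightarrow> form \<Rightarrow> form" where
  "shift k (Var i) = Var (i + k)"
| "shift k (Imp \<psi> \<phi>) = Imp (shift k \<psi>) (shift k \<phi>)"

lemma var_list_nonempty: "var_list \<phi> \<noteq> []"
  by (induction \<phi>) auto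

lemma var_list_shift: "var_list (shift k \<phi>) = map (\<lambda>i. i + k) (var_list \<phi>)"
  by (induction \<phi>) auto

lemma eval_shift: "eval v (shift k \<phi>) = eval (\<lambda>i. v (i + k)) \<phi>"
  by (induction \<phi>) auto

lemma eval_cong:
  assumes "\<And>i. i \<in> set (var_list \<phi>) \<Longrightarrow> u i = v i"
  shows "eval u \<phi> = eval v \<phi>"
  using assms by (induction \<phi>) auto

lemma inj_shift: "inj (shift k)"
proof (rule injI)
  fix \<psi> \<phi> assume "shift k \<psi> = shift k \<phi>"
  then show "\<psi> = \<phi>"
  proof (induction \<psi> arbitrary: \<phi>)
    case (Var i)
    then show ?case by (cases \<phi>) auto
  next
    case (Imp \<psi>1 \<psi>2)
    then show ?case by (cases \<phi>) auto
  qed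
qed

text \<open>With every index at least \<open>k\<close>, truncated subtraction of \<open>k\<close>
  loses nothing and adding \<open>k\<close> undoes it. This brings a consequent back to indices
  starting at 1.\<close>

lemma ex_shift:
  assumes "\<And>i. i \<in> set (var_list \<phi>) \<Longrightarrow> k \<le> i"
  shows "\<exists>\<phi>'. \<phi> = shift k \<phi>'"
  using assms
proof (induction \<phi>)
  case (Var i)
  then have "Var i = shift k (Var (i - k))" by simp
  then show ?case by blast
next
  case (Imp \<psi> \<phi>)
  then obtain \<psi>' \<phi>' where "\<psi> = shift k \<psi>'" "\<phi> = shift k \<phi>'" by auto
  then have "Imp \<psi> \<phi> = shift k (Imp \<psi>' \<phi>')" by simp
  then show ?case by blast
qed

text \<open>The outermost arrow cuts \<open>xs\<close> into two nonempty, hence shorter, lists, so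
  induction on the length applies. Arbitrary lists are needed because the second piece of a chain no
  longer starts at 1. Without finiteness \<open>card\<close> would default to 0.\<close>

lemma finite_var_list_eq: "finite {\<phi>. var_list \<phi> = xs}"
proof (induction xs rule: length_induct)
  case (1 xs)
  let ?S = "\<lambda>ys. {\<phi>. var_list \<phi> = ys}"
  \<comment> \<open>The range of \<open>k\<close> leaves out 0 and \<open>length xs\<close>, so the
    induction hypothesis covers both pieces.\<close>
  let ?C = "\<Union>k\<in>{1..<length xs}. (\<lambda>(\<psi>, \<phi>). Imp \<psi> \<phi>) ` (?S (take k xs) \<times> ?S (drop k xs))"
  have "?S xs \<subseteq> Var ` set xs \<union> ?C"
  proof
    fix \<chi> assume "\<chi> \<in> ?S xs"
    then have xs: "var_list \<chi> = xs" by simp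
    show "\<chi> \<in> Var ` set xs \<union> ?C"
    proof (cases \<chi>)
      case (Var i)
      then show ?thesis using xs by auto
    next
      case (Imp \<psi> \<phi>)
      let ?k = "length (var_list \<psi>)"
      have "?k \<in> {1..<length xs}"
        using xs Imp var_list_nonempty[of \<psi>] var_list_nonempty[of \<phi>] by (auto simp: Suc_le_eq)
      moreover have "(\<psi>, \<phi>) \<in> ?S (take ?k xs) \<times> ?S (drop ?k xs)"
        using xs Imp by auto
      ultimately show ?thesis using Imp by fast
    qed
  qed
  moreover have "finite ?C" using 1 by (intro finite_UN_I finite_imageI finite_cartesian_product) auto
  ultimately show ?case by (meson List.finite_set finite_UnI finite_imageI finite_subset)
qed

lemma finite_rows: "finite (rows n)"
  unfolding rows_def bracketed_def valuations_def
  by (intro finite_cartesian_product finite_var_list_eq finite_PiE) auto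

section \<open>Cutting a bracketed formula at its outermost arrow\<close>

lemma map_add_right_upt: "map (\<lambda>i. i + k) [m..<n] = [m + k..<n + k]"
  by (rule nth_equalityI) auto

text \<open>The antecedent uses up a nonempty proper prefix 1, ..., i of the chain; what remains,
  i+1, ..., n, is the chain of length n - i raised by i.\<close>

lemma Imp_in_bracketed:
  "Imp \<psi> \<phi> \<in> bracketed n \<longleftrightarrow>
    (\<exists>i\<in>{1..n-1}. \<psi> \<in> bracketed i \<and> (\<exists>\<phi>'\<in>bracketed (n - i). \<phi> = shift i \<phi>'))"
proof
  assume "Imp \<psi> \<phi> \<in> bracketed n"
  then have eq: "var_list \<psi> @ var_list \<phi> = [1..<Suc n]" by (simp add: bracketed_def)
  define i where "i = length (var_list \<psi>)"
  have "length (var_list \<psi>) + length (var_list \<phi>) = n"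
    using arg_cong[OF eq, of length] by simp
  then have i: "1 \<le> i" "i < n"
    using var_list_nonempty[of \<psi>] var_list_nonempty[of \<phi>] by (auto simp: i_def Suc_le_eq)
  have "var_list \<psi> = take i [1..<Suc n]" unfolding eq[symmetric] by (simp add: i_def)
  then have \<psi>: "var_list \<psi> = [1..<Suc i]" using i by (simp add: take_upt del: upt_Suc)
  have "var_list \<phi> = drop i [1..<Suc n]" unfolding eq[symmetric] by (simp add: i_def)
  then have \<phi>: "var_list \<phi> = [Suc i..<Suc n]" by (simp add: drop_upt del: upt_Suc)
  obtain \<phi>' where \<phi>': "\<phi> = shift i \<phi>'" using ex_shift[of \<phi> i] by (auto simp: \<phi> simp del: upt_Suc)
  \<comment> \<open>Both lists are compared after raising by \<open>i\<close>; injectivity of this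
    map then cancels it.\<close>
  have "map (\<lambda>j. j + i) (var_list \<phi>') = map (\<lambda>j. j + i) [1..<Suc (n - i)]"
    using i \<phi> by (simp add: \<phi>' var_list_shift map_add_right_upt Suc_diff_le del: upt_Suc)
  then have "var_list \<phi>' = [1..<Suc (n - i)]" by (simp add: inj_map_eq_map inj_def del: upt_Suc)
  then show "\<exists>i\<in>{1..n-1}. \<psi> \<in> bracketed i \<and> (\<exists>\<phi>'\<in>bracketed (n - i). \<phi> = shift i \<phi>')"
    using i \<psi> \<phi>' by (intro bexI[of _ i]) (auto simp: bracketed_def simp del: upt_Suc)
next
  assume "\<exists>i\<in>{1..n-1}. \<psi> \<in> bracketed i \<and> (\<exists>\<phi>'\<in>bracketed (n - i). \<phi> = shift i \<phi>')"
  then obtain i \<phi>' where i: "1 \<le> i" "i \<le> n - 1" and \<psi>: "var_list \<psi> = [1..<Suc i]"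
    and \<phi>': "var_list \<phi>' = [1..<Suc (n - i)]" "\<phi> = shift i \<phi>'"
    by (auto simp: bracketed_def simp del: upt_Suc)
  have "var_list \<phi> = [Suc i..<Suc n]"
    using i by (simp add: \<phi>' var_list_shift map_add_right_upt del: upt_Suc)
  then show "Imp \<psi> \<phi> \<in> bracketed n"
    \<comment> \<open>The interval is cut at \<open>Suc i\<close>, since
      \<open>Suc i + (n - i) = Suc n\<close>.\<close>
    using i \<psi> upt_add_eq_append[of 1 "Suc i" "n - i"] by (simp add: bracketed_def del: upt_Suc)
qed

section \<open>Gluing and cutting valuations\<close>

lemma set_var_list_bracketed: "\<phi> \<in> bracketed n \<Longrightarrow> set (var_list \<phi>) = {1..n}"
  by (auto simp: bracketed_def simp del: upt_Suc)

lemma length_var_list_bracketed: "\<phi> \<in> bracketed n \<Longrightarrow> length (var_list \<phi>) = n"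
  by (simp add: bracketed_def del: upt_Suc)

lemma valuations_eqI:
  assumes "u \<in> valuations n" "v \<in> valuations n" "\<And>i. i \<in> {1..n} \<Longrightarrow> u i = v i"
  shows "u = v"
  using assms unfolding valuations_def by (rule PiE_ext)

lemma restrict_in_valuations: "restrict v {1..n} \<in> valuations n"
  by (simp add: valuations_def)

text \<open>Lowering the index for \<open>w\<close> matches \<open>shift i\<close> on the
  consequent. Restricting to \<open>{1..n}\<close> gives the value \<open>undefined\<close>
  elsewhere, as membership in \<open>valuations n\<close> demands.\<close>

definition join :: "nat \<Rightarrow> nat \<Rightarrow> (nat \<Rightarrow> bool) \<Rightarrow> (nat \<Rightarrow> bool) \<Rightarrow> nat \<Rightarrow> bool" where
  "join n i u w = (\<lambda>j\<in>{1..n}. if j \<le> i then u j else w (j - i))"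

lemma join_left: "j \<in> {1..i} \<Longrightarrow> i \<le> n \<Longrightarrow> join n i u w j = u j"
  by (simp add: join_def)

text \<open>As \<open>j\<close> is at least 1, \<open>j + i\<close> exceeds \<open>i\<close> and so
  falls under the second branch.\<close>

lemma join_right: "j \<in> {1..n - i} \<Longrightarrow> join n i u w (j + i) = w j"
  by (auto simp: join_def)

text \<open>Supplies the preimage for surjectivity: any valuation is recovered from its two
  pieces.\<close>

lemma join_split:
  assumes "v \<in> valuations n" "i \<le> n"
  shows "join n i (restrict v {1..i}) (\<lambda>j\<in>{1..n-i}. v (j + i)) = v"
  using assms by (intro valuations_eqI[of _ n]) (auto simp: join_def valuations_def)

lemma eval_join_left:
  assumes "\<psi> \<in> bracketed i" "i \<le> n"
  shows "eval (join n i u w) \<psi> = eval u \<psi>"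
  using assms by (intro eval_cong join_left) (simp_all add: set_var_list_bracketed)

lemma eval_join_right:
  assumes "\<phi> \<in> bracketed (n - i)"
  shows "eval (join n i u w) (shift i \<phi>) = eval w \<phi>"
  unfolding eval_shift using assms
  by (intro eval_cong join_right) (simp add: set_var_list_bracketed)

section \<open>Counting the rows of each case\<close>

definition value_rows :: "bool \<Rightarrow> nat \<Rightarrow> row set" where
  "value_rows b n = {r \<in> rows n. row_value r = b}"

lemma value_rows_iff:
  "(\<phi>, v) \<in> value_rows b n \<longleftrightarrow> \<phi> \<in> bracketed n \<and> v \<in> valuations n \<and> eval v \<phi> = b"
  by (auto simp: value_rows_def rows_def row_value_def)

lemma case_rows_iff:
  "(\<chi>, v) \<in> case_rows a b n \<longleftrightarrow>
    (\<exists>\<psi> \<phi>. \<chi> = Imp \<psi> \<phi> \<and> Imp \<psi> \<phi> \<in> bracketed n \<and> v \<in> valuations n \<and> eval v \<psi> = a \<and> eval v \<phi> = b)"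
  by (auto simp: case_rows_def rows_def)

lemma finite_value_rows: "finite (value_rows b n)"
  by (simp add: value_rows_def finite_rows)

lemma finite_case_rows: "finite (case_rows a b n)"
  by (rule finite_subset[OF _ finite_rows[of n]]) (auto simp: case_rows_def)

fun combine :: "nat \<Rightarrow> nat \<times> row \<times> row \<Rightarrow> row" where
  "combine n (i, (\<psi>, u), (\<phi>, w)) = (Imp \<psi> (shift i \<phi>), join n i u w)"

text \<open>The tag \<open>i\<close> keeps the products for different cut positions disjoint, so the
  cardinality of the domain becomes a sum. With \<open>a\<close> and \<open>b\<close> as parameters,
  one bijection yields all four recurrences.\<close>

lemma bij_betw_combine:
  "bij_betw (combine n) (SIGMA i:{1..n-1}. value_rows a i \<times> value_rows b (n - i)) (case_rows a b n)"
    (is "bij_betw _ ?D _")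
  unfolding bij_betw_def
proof
  show "inj_on (combine n) ?D"
  proof (rule inj_onI)
    fix x y assume x: "x \<in> ?D" and y: "y \<in> ?D" and eq: "combine n x = combine n y"
    obtain i \<psi> u \<phi> w where xe: "x = (i, (\<psi>, u), (\<phi>, w))" by (metis surj_pair)
    obtain i' \<psi>' u' \<phi>' w' where ye: "y = (i', (\<psi>', u'), (\<phi>', w'))" by (metis surj_pair)
    have "\<psi> = \<psi>'" using eq by (simp add: xe ye)
    moreover have "\<psi> \<in> bracketed i" "\<psi>' \<in> bracketed i'"
      using x y by (simp_all add: xe ye value_rows_iff)
    \<comment> \<open>The cut position can be read off the combined row as the number of variables
      in the antecedent.\<close>
    ultimately have ii: "i' = i" using length_var_list_bracketed by blast
    then have "\<phi> = \<phi>'" using eq injD[OF inj_shift] by (auto simp: xe ye)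
    have i: "i \<le> n" using x by (auto simp: xe)
    have j: "join n i u w = join n i u' w'" using eq ii by (simp add: xe ye)
    have "u = u'"
    proof (rule valuations_eqI[of _ i])
      \<comment> \<open>Positions 1 to i of the glued valuation determine \<open>u\<close>, the
        later ones \<open>w\<close>; outside their ranges the pieces are
        \<open>undefined\<close>.\<close>
      show "u k = u' k" if "k \<in> {1..i}" for k
        using fun_cong[OF j, of k] that i by (simp add: join_left)
    qed (use x y ii in \<open>auto simp: xe ye value_rows_iff\<close>)
    moreover have "w = w'"
    proof (rule valuations_eqI[of _ "n - i"])
      show "w k = w' k" if "k \<in> {1..n - i}" for k
        using fun_cong[OF j, of "k + i"] by (simp only: join_right[OF that])
    qed (use x y ii in \<open>auto simp: xe ye value_rows_iff\<close>)
    ultimately show "x = y" using \<open>\<psi> = \<psi>'\<close> \<open>\<phi> = \<phi>'\<close> ii by (simp add: xe ye)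
  qed
next
  show "combine n ` ?D = case_rows a b n"
  proof (intro equalityI subsetI)
    fix r assume "r \<in> combine n ` ?D"
    then obtain i \<psi> u \<phi> w where i: "i \<in> {1..n-1}" and \<psi>: "(\<psi>, u) \<in> value_rows a i"
      and \<phi>: "(\<phi>, w) \<in> value_rows b (n - i)" and r: "r = (Imp \<psi> (shift i \<phi>), join n i u w)"
      by auto
    have "Imp \<psi> (shift i \<phi>) \<in> bracketed n"
      using i \<psi> \<phi> by (auto simp: Imp_in_bracketed value_rows_iff)
    moreover have "join n i u w \<in> valuations n"
      unfolding join_def by (rule restrict_in_valuations)
    ultimately show "r \<in> case_rows a b n"
      using i \<psi> \<phi> by (auto simp: r case_rows_iff value_rows_iff eval_join_left eval_join_right)
  next
    fix r assume "r \<in> case_rows a b n"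
    then obtain \<psi> \<phi> v where r: "r = (Imp \<psi> \<phi>, v)" and in_br: "Imp \<psi> \<phi> \<in> bracketed n"
      and v: "v \<in> valuations n" and ev: "eval v \<psi> = a" "eval v \<phi> = b"
      by (cases r) (auto simp: case_rows_iff)
    obtain i \<phi>' where i: "i \<in> {1..n-1}" and \<psi>: "\<psi> \<in> bracketed i"
      and \<phi>': "\<phi>' \<in> bracketed (n - i)" "\<phi> = shift i \<phi>'"
      using in_br by (auto simp: Imp_in_bracketed)
    define u where "u = restrict v {1..i}"
    define w where "w = (\<lambda>j\<in>{1..n-i}. v (j + i))"
    have i': "i \<le> n" using i by auto
    have j: "join n i u w = v" unfolding u_def w_def using v i' by (rule join_split)
    \<comment> \<open>Since \<open>v\<close> is the join of \<open>u\<close> and \<open>w\<close>,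
      the evaluation lemmas for joins transfer the values under \<open>v\<close> to the two
      pieces.\<close>
    have "(\<psi>, u) \<in> value_rows a i"
      using \<psi> ev eval_join_left[OF \<psi> i', of u w, unfolded j] restrict_in_valuations[of v i]
      by (simp add: value_rows_iff u_def)
    moreover have "(\<phi>', w) \<in> value_rows b (n - i)"
      using \<phi>' ev eval_join_right[OF \<phi>'(1), of u w, folded \<phi>'(2), unfolded j] restrict_in_valuations[of "\<lambda>j. v (j + i)" "n - i"]
      by (simp add: value_rows_iff w_def)
    ultimately have "(i, (\<psi>, u), (\<phi>', w)) \<in> ?D" using i by blast
    moreover have "r = combine n (i, (\<psi>, u), (\<phi>', w))" by (simp add: r j \<phi>')
    ultimately show "r \<in> combine n ` ?D" by blast
  qed
qed

lemma card_case_rows: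
  "card (case_rows a b n) = (\<Sum>i=1..n-1. card (value_rows a i) * card (value_rows b (n - i)))"
proof -
  have "card (case_rows a b n) = card (SIGMA i:{1..n-1}. value_rows a i \<times> value_rows b (n - i))"
    using bij_betw_same_card[OF bij_betw_combine] by metis
  then show ?thesis by (simp add: card_SigmaI finite_value_rows card_cartesian_product)
qed

section \<open>Partition of all rows, and the base case\<close>

lemma t_eq: "t n = card (value_rows True n)"
  by (simp add: t_def true_rows_def value_rows_def)

lemma f_eq: "f n = card (value_rows False n)"
  by (simp add: f_def false_rows_def value_rows_def)

lemma g_eq: "g n = t n + f n"
proof -
  have "rows n = true_rows n \<union> false_rows n" by (auto simp: true_rows_def false_rows_def)
  then show ?thesis
    unfolding g_def t_def f_def
    using finite_rows[of n] by (subst card_Un_disjoint[symmetric]) (auto simp: true_rows_def false_rows_def)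
qed

text \<open>A lone variable has a variable list of length 1, which \<open>n \<ge> 2\<close> rules
  out.\<close>

lemma rows_Imp:
  assumes "r \<in> rows n" "n \<ge> 2"
  obtains \<psi> \<phi> v where "r = (Imp \<psi> \<phi>, v)"
proof (cases r)
  case (Pair \<chi> v)
  then have "length (var_list \<chi>) = n"
    using assms(1) by (simp add: rows_def length_var_list_bracketed)
  then show ?thesis using that assms(2) Pair by (cases \<chi>) auto
qed

text \<open>An implication fails only for a true antecedent and a false consequent. For
  \<open>n = 1\<close> the equation breaks down: there is a false row, but no implication.\<close>

lemma false_rows_eq:
  assumes "n \<ge> 2"
  shows "false_rows n = case_rows True False n"
proof (intro equalityI subsetI)
  fix r assume r: "r \<in> false_rows n"
  then obtain \<psi> \<phi> v where "r = (Imp \<psi> \<phi>, v)"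
    using assms rows_Imp unfolding false_rows_def by blast
  with r show "r \<in> case_rows True False n"
    by (auto simp: false_rows_def case_rows_def row_value_def)
qed (auto simp: false_rows_def case_rows_def row_value_def)

lemma rows_eq:
  assumes "n \<ge> 2"
  shows "rows n = case_rows True True n \<union> case_rows False True n \<union> case_rows False False n
    \<union> case_rows True False n"
proof (intro equalityI subsetI)
  fix r assume r: "r \<in> rows n"
  then obtain \<psi> \<phi> v where "r = (Imp \<psi> \<phi>, v)" using assms rows_Imp by blast
  with r show "r \<in> case_rows True True n \<union> case_rows False True n \<union> case_rows False False n
    \<union> case_rows True False n"
    by (auto simp: case_rows_def)
qed (auto simp: case_rows_def)

text \<open>A row determines its antecedent and consequent, hence both their values.\<close>

lemma case_rows_disjoint: "(a, b) \<noteq> (a', b') \<Longrightarrow> case_rows a b n \<inter> case_rows a' b' n = {}"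
  by (auto simp: case_rows_def)

lemma value_rows_False_1: "value_rows False 1 = {(Var 1, \<lambda>j\<in>{1}. False)}"
proof -
  \<comment> \<open>For \<open>n = 1\<close> the range of cut positions is empty, which excludes
    implications.\<close>
  have \<chi>: "\<chi> \<in> bracketed 1 \<longleftrightarrow> \<chi> = Var 1" for \<chi>
    by (cases \<chi>) (auto simp: Imp_in_bracketed, auto simp: bracketed_def)
  have v: "v \<in> valuations 1 \<and> \<not> v 1 \<longleftrightarrow> v = (\<lambda>j\<in>{1}. False)" for v
    by (auto simp: valuations_def PiE_iff extensional_def fun_eq_iff)
  have "(\<chi>, v) \<in> value_rows False 1 \<longleftrightarrow> \<chi> = Var 1 \<and> v \<in> valuations 1 \<and> \<not> v 1" for \<chi> v
    unfolding value_rows_iff \<chi> by auto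
  then show ?thesis unfolding v by (simp only: set_eq_iff split_paired_All singleton_iff prod.inject simp_thms)
qed

theorem theorem3p1:
  shows "(\<forall>n\<ge>1. g n = t n + f n)
    \<and> (\<forall>n\<ge>2.
        rows n = case_rows True True n \<union> case_rows False True n \<union> case_rows False False n \<union> false_rows n
      \<and> disjoint_family_on
          (\<lambda>k. [case_rows True True n, case_rows False True n, case_rows False False n, false_rows n] ! k)
          {..<4}
      \<and> g n = t1 n + t2 n + t3 n + f n
      \<and> t1 n = (\<Sum>i=1..n-1. t i * t (n - i))
      \<and> t2 n = (\<Sum>i=1..n-1. f i * t (n - i))
      \<and> t3 n = (\<Sum>i=1..n-1. f i * f (n - i))
      \<and> f n = (\<Sum>i=1..n-1. t i * f (n - i)))
    \<and> t1 1 = 0 \<and> t2 1 = 0 \<and> t3 1 = 0 \<and> f 1 = 1"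
proof (intro conjI allI impI)
  fix n :: nat assume n: "n \<ge> 2"
  show "rows n = case_rows True True n \<union> case_rows False True n \<union> case_rows False False n \<union> false_rows n"
    using rows_eq[OF n] by (simp only: false_rows_eq[OF n])
  show "disjoint_family_on
      (\<lambda>k. [case_rows True True n, case_rows False True n, case_rows False False n, false_rows n] ! k)
      {..<4}"
    unfolding false_rows_eq[OF n] disjoint_family_on_def
    by (auto simp: case_rows_def less_Suc_eq numeral_eq_Suc)
  show "g n = t1 n + t2 n + t3 n + f n"
    unfolding g_def t1_def t2_def t3_def f_def false_rows_eq[OF n] rows_eq[OF n]
    by (simp add: card_Un_disjoint finite_case_rows Int_Un_distrib2 case_rows_disjoint)
  \<comment> \<open>Only the left-hand \<open>f n\<close> is unfolded into a cardinality; the terms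
    \<open>f (n - i)\<close> are matched through \<open>f_eq\<close>.\<close>
  show "f n = (\<Sum>i=1..n-1. t i * f (n - i))"
    unfolding f_def[of n] false_rows_eq[OF n] by (simp add: card_case_rows t_eq f_eq)
\<comment> \<open>The sums for \<open>t1\<close>, \<open>t2\<close> and \<open>t3\<close> are
  instances of \<open>card_case_rows\<close>. At \<open>n = 1\<close> they are empty, giving 0, and
  \<open>f 1\<close> counts a single row.\<close>
qed (simp_all add: g_eq t1_def t2_def t3_def card_case_rows t_eq f_eq value_rows_False_1[simplified])

end
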